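(* Let $k\ge3$, and let $G$ be a stable blow-up of a graph $H$. Then $G$ is an exact $k$-leaf power if and only if $H$ is an exact $k$-leaf power.
   Context: Graphs are finite, simple, undirected and nonempty. A graph $G$ is an exact $k$-leaf power if there is a tree $T$ whose leaf set is $V(G)$ such that for distinct $u,v\in V(G)$, $uv\in E(G)$ if and only if $\operatorname{dist}_T(u,v)=k$; the vertex of a one-vertex tree counts as a leaf. A stable blow-up of a graph $H$ is a graph obtained by replacing each vertex $v\in V(H)$ by a nonempty (finite) stable set $I_v$ (these sets being pairwise disjoint), and adding all edges between $I_u$ and $I_v$ whenever $uv\in E(H)$ (and no other edges). *)

theory Defs
  imports "Graph_Theory.Graph_Theory" "HOL-Library.Disjoint_Sets"
begin

text \<open>
  As in the library, an undirected graph is a symmetric loop-free digraph: every edge is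
  represented by its two arcs.
\<close>

definition simple_graph :: "'a pair_pre_digraph \<Rightarrow> bool" where
  "simple_graph G \<longleftrightarrow> pair_graph G \<and> pverts G \<noteq> {}"

text \<open>
  The library predicate \<open>tree\<close> cannot be used for symmetric digraphs, since there the closed
  walk \<open>a, b, a\<close> along a single edge is a \<open>cycle\<close>. The undirected cycles are the
  \<open>cycle\<close>s of length at least 3.
\<close>

definition undirected_tree :: "'a pair_pre_digraph \<Rightarrow> bool" where
  "undirected_tree T \<longleftrightarrow> simple_graph T \<and> connected (with_proj T) \<and>
     \<not> (\<exists>p. pre_digraph.cycle (with_proj T) p \<and> length p \<ge> 3)"

text \<open>In a symmetric digraph the out-degree is the undirected degree.\<close>

definition leaves :: "'a pair_pre_digraph \<Rightarrow> 'a set" where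
  "leaves T = {v \<in> pverts T. out_degree (with_proj T) v = 1 \<or> pverts T = {v}}"

definition graph_dist :: "'a pair_pre_digraph \<Rightarrow> 'a \<Rightarrow> 'a \<Rightarrow> ereal" where
  "graph_dist G u v = wf_digraph.\<mu> (with_proj G) (\<lambda>_. 1) u v"

text \<open>
  The leaf set of the tree is identified with the vertex set of \<open>G\<close> along a bijection
  \<open>\<phi>\<close>. Since trees are finite, taking natural numbers as their vertices is no restriction.
\<close>

definition exact_leaf_power :: "nat \<Rightarrow> 'a pair_pre_digraph \<Rightarrow> bool" where
  "exact_leaf_power k G \<longleftrightarrow>
     (\<exists>(T :: nat pair_pre_digraph) (\<phi> :: 'a \<Rightarrow> nat).
        undirected_tree T \<and> bij_betw \<phi> (pverts G) (leaves T) \<and>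
        (\<forall>u \<in> pverts G. \<forall>v \<in> pverts G. u \<noteq> v \<longrightarrow>
           ((u, v) \<in> parcs G \<longleftrightarrow> graph_dist T (\<phi> u) (\<phi> v) = ereal (real k))))"

definition stable_blow_up :: "'b pair_pre_digraph \<Rightarrow> 'a pair_pre_digraph \<Rightarrow> bool" where
  "stable_blow_up G H \<longleftrightarrow>
     (\<exists>I :: 'a \<Rightarrow> 'b set.
        (\<forall>v \<in> pverts H. finite (I v) \<and> I v \<noteq> {}) \<and>
        disjoint_family_on I (pverts H) \<and>
        pverts G = (\<Union>v \<in> pverts H. I v) \<and>
        parcs G = (\<Union>(u, v) \<in> parcs H. I u \<times> I v))"

lemma simple_graph_stable_blow_up:
  assumes H: "simple_graph H" and G: "stable_blow_up G H"
  shows "simple_graph G"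
proof -
  from H have H': "pair_graph H" and neH: "pverts H \<noteq> {}" by (simp_all add: simple_graph_def)
  note wf = pair_wf_digraph.in_arcsD1 pair_wf_digraph.in_arcsD2
  have wfH: "pair_wf_digraph H" and finH: "finite (pverts H)"
    and symH: "sym (parcs H)" and nolH: "\<And>e. e \<in> parcs H \<Longrightarrow> fst e \<noteq> snd e"
    using H' by (simp_all add: pair_graph_def pair_digraph_def pair_pseudo_graph_def
        pair_fin_digraph_def pair_fin_digraph_axioms_def pair_sym_digraph_def
        pair_sym_digraph_axioms_def symmetric_def pair_loopfree_digraph_def
        pair_loopfree_digraph_axioms_def)
  from G obtain I where fin: "\<forall>v \<in> pverts H. finite (I v) \<and> I v \<noteq> {}"
    and dis: "disjoint_family_on I (pverts H)"
    and V: "pverts G = (\<Union>v \<in> pverts H. I v)"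
    and E: "parcs G = (\<Union>(u, v) \<in> parcs H. I u \<times> I v)"
    unfolding stable_blow_up_def by (elim exE conjE)
  have arcI: "(x, y) \<in> parcs G" if "(u, v) \<in> parcs H" "x \<in> I u" "y \<in> I v" for u v x y
    unfolding E using that by blast
  have arcE: "\<exists>u v. (u, v) \<in> parcs H \<and> x \<in> I u \<and> y \<in> I v" if "(x, y) \<in> parcs G" for x y
    using that unfolding E by blast
  have finV: "finite (pverts G)" unfolding V by (rule finite_UN_I) (use finH fin in blast)+
  have sub: "x \<in> pverts G \<and> y \<in> pverts G" if "(x, y) \<in> parcs G" for x y
    using arcE[OF that] wf[OF wfH] unfolding V by blast
  have finE: "finite (parcs G)"
    by (rule finite_subset[OF _ finite_cartesian_product[OF finV finV]]) (use sub in auto)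
  have sym: "sym (parcs G)"
  proof (rule symI)
    fix x y assume "(x, y) \<in> parcs G"
    then obtain u v where "(u, v) \<in> parcs H" "x \<in> I u" "y \<in> I v" using arcE by blast
    then show "(y, x) \<in> parcs G" using arcI symD[OF symH] by blast
  qed
  have nol: "x \<noteq> y" if xy: "(x, y) \<in> parcs G" for x y
  proof
    assume "x = y"
    with arcE[OF xy] obtain u v where uv: "(u, v) \<in> parcs H" and x: "x \<in> I u" "x \<in> I v" by blast
    have "u \<noteq> v" using nolH[OF uv] by simp
    then have "I u \<inter> I v = {}"
      using dis wf(1)[OF wfH uv] wf(2)[OF wfH uv] unfolding disjoint_family_on_def by blast
    with x show False by blast
  qed
  have wfG: "pair_wf_digraph G"
    by (rule pair_wf_digraph.intro) (use sub prod.collapse in metis)+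
  have "pair_graph G"
    unfolding pair_graph_def pair_digraph_def pair_pseudo_graph_def
        pair_fin_digraph_def pair_fin_digraph_axioms_def pair_sym_digraph_def
        pair_sym_digraph_axioms_def symmetric_def pair_loopfree_digraph_def
        pair_loopfree_digraph_axioms_def with_proj_simps
    by (intro conjI allI impI wfG finV finE sym) (use nol prod.collapse in metis)
  moreover have "pverts G \<noteq> {}" unfolding V using fin neH by blast
  ultimately show ?thesis by (simp add: simple_graph_def)
qed

end

theory Submission
  imports Defs
begin

text \<open>
  Let \<open>G\<close> be obtained from \<open>H\<close> by replacing every vertex \<open>v\<close> by a stable set \<open>I v\<close>.

  From \<open>G\<close> to \<open>H\<close>: choosing one vertex in each \<open>I v\<close> embeds \<open>H\<close> as an induced subgraph of
  \<open>G\<close>. In a tree that represents \<open>G\<close>, delete leaves that do not belong to chosen vertices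
  until none is left; this creates other leaves, which are deleted in turn. A chosen leaf
  remains a leaf throughout, and distances between the remaining vertices do not change
  (\<open>prune_to_leaf_subset\<close>).

  From \<open>H\<close> to \<open>G\<close>: the vertices of \<open>G\<close> are added one at a time to the copy of \<open>H\<close>, each as
  a false twin of a vertex that is already there (\<open>leaf_root_add_twin\<close>). In the tree, the twin
  of a leaf \<open>l\<close> is a new leaf at the neighbour \<open>p\<close> of \<open>l\<close>. It has the same distances as \<open>l\<close>
  to all other vertices, and its distance to \<open>l\<close> is at most \<open>2 < k\<close>, so the twins are not
  adjacent. If the tree has at least three vertices, then \<open>p\<close> is not itself a leaf and no other
  leaf is lost. A smaller tree has no two vertices at distance \<open>k\<close>, so it
  represents one vertex or two isolated ones. The path with three vertices then represents the
  one vertex together with its twin, or takes the place of the tree of the two isolated vertices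
  (\<open>leaf_root_large_tree\<close>).

  Distances in two trees are compared through the fact that graph homomorphisms do not increase
  them (\<open>graph_dist_hom_le\<close>). If a leaf is attached to a vertex \<open>y\<close> of a tree with at least
  two vertices, then the new tree folds back onto the old one by mapping the new leaf to a
  neighbour of \<open>y\<close>.
\<close>

section \<open>Trees and distances\<close>

lemma pcas_append: "pcas u (p @ q) w \<longleftrightarrow> (\<exists>v. pcas u p v \<and> pcas v q w)"
  by (induct p arbitrary: u) auto

lemma tl_pawalk_verts: "pcas u p v \<Longrightarrow> tl (pawalk_verts u p) = map snd p"
proof (induct p arbitrary: u)
  case (Cons e p)
  then show ?case by (cases p) auto
qed simp

text \<open>
  Together with \<open>undirected_tree_iff\<close> below, this replaces locale predicates by properties of
  the vertex set and the arc relation, on which adding and removing a leaf is easy to track.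
\<close>

lemma pair_graph_iff:
  "pair_graph T \<longleftrightarrow> finite (pverts T) \<and> parcs T \<subseteq> pverts T \<times> pverts T
     \<and> sym (parcs T) \<and> irrefl (parcs T)" (is "_ \<longleftrightarrow> ?R")
proof
  assume "pair_graph T"
  then interpret pair_graph T .
  have "(a, a) \<notin> parcs T" for a
    using no_loops' by blast
  moreover have "sym (parcs T)"
    by (rule symI) (rule arcs_symmetric)
  moreover have "parcs T \<subseteq> pverts T \<times> pverts T"
    using wellformed' by (intro subrelI) blast
  ultimately show ?R
    using pair_finite_verts by (simp add: irrefl_def)
next
  assume R: ?R
  interpret pair_wf_digraph T
    by unfold_locales (use R in auto)
  have "finite (parcs T)"
    using R finite_subset[of "parcs T" "pverts T \<times> pverts T"] by simp
  moreover have "symmetric (with_proj T)"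
    using R by (simp add: symmetric_def)
  moreover have "fst e \<noteq> snd e" if "e \<in> parcs T" for e
    using that R by (cases e) (auto simp: irrefl_def)
  ultimately show "pair_graph T"
    using R by unfold_locales simp_all
qed

lemma undirected_tree_iff:
  "undirected_tree T \<longleftrightarrow> finite (pverts T) \<and> pverts T \<noteq> {}
     \<and> parcs T \<subseteq> pverts T \<times> pverts T \<and> sym (parcs T) \<and> irrefl (parcs T)
     \<and> (\<forall>u \<in> pverts T. \<forall>v \<in> pverts T. (u, v) \<in> (parcs T)\<^sup>*)
     \<and> (\<forall>u p. set p \<subseteq> parcs T \<longrightarrow> pcas u p u \<longrightarrow> distinct (map snd p) \<longrightarrow> length p < 3)"
    (is "_ \<longleftrightarrow> ?R")
proof (cases "pair_graph T")
  case True
  then interpret pair_graph T .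
  have "u \<rightarrow>\<^sup>*\<^bsub>mk_symmetric (with_proj T)\<^esub> v \<longleftrightarrow> (u, v) \<in> (parcs T)\<^sup>*" if "u \<in> pverts T" for u v
    using reachable_mk_symmetric_eq[OF sym_arcs] reachable_conv'[OF that] by simp
  then have con: "connected (with_proj T) \<longleftrightarrow>
      pverts T \<noteq> {} \<and> (\<forall>u \<in> pverts T. \<forall>v \<in> pverts T. (u, v) \<in> (parcs T)\<^sup>*)"
    unfolding connected_def strongly_connected_def by simp
  have cyc: "(cycle p \<and> length p \<ge> 3) \<longleftrightarrow>
      (\<exists>u. set p \<subseteq> parcs T \<and> pcas u p u \<and> distinct (map snd p) \<and> length p \<ge> 3)" for p
  proof -
    have "u \<in> pverts T" if "set p \<subseteq> parcs T" "pcas u p u" "length p \<ge> 3" for u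
      using that wellformed' by (cases p) auto
    then show ?thesis
      unfolding cycle_def awalk_def using tl_pawalk_verts[of _ p] by fastforce
  qed
  show ?thesis
    using True con unfolding undirected_tree_def simple_graph_def cyc not_le[symmetric]
    unfolding pair_graph_iff by blast
next
  case False
  then show ?thesis
    unfolding undirected_tree_def simple_graph_def pair_graph_iff by blast
qed

lemma mem_leaves_iff:
  "v \<in> leaves T \<longleftrightarrow> v \<in> pverts T \<and> ((\<exists>w. \<forall>z. (v, z) \<in> parcs T \<longleftrightarrow> z = w) \<or> pverts T = {v})"
proof -
  have "out_arcs (with_proj T) v = Pair v ` {z. (v, z) \<in> parcs T}"
    by (auto simp: out_arcs_def)
  then have "out_degree (with_proj T) v = card {z. (v, z) \<in> parcs T}"
    unfolding out_degree_def by (simp add: card_image inj_on_def)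
  then have "out_degree (with_proj T) v = 1 \<longleftrightarrow> (\<exists>w. \<forall>z. (v, z) \<in> parcs T \<longleftrightarrow> z = w)"
    by (auto simp: card_1_singleton_iff)
  then show ?thesis by (auto simp: leaves_def)
qed

lemma tree_imp_pair_wf: "undirected_tree T \<Longrightarrow> pair_wf_digraph T"
  by (auto simp: undirected_tree_iff pair_wf_digraph_def)

lemma graph_dist_conv:
  assumes "pair_wf_digraph T"
  shows "graph_dist T u v =
    (INF p \<in> {p. u \<in> pverts T \<and> set p \<subseteq> parcs T \<and> pcas u p v}. ereal (real (length p)))"
proof -
  interpret pair_wf_digraph T by fact
  have "awalk_cost (\<lambda>_. 1) p = real (length p)" for p
    unfolding awalk_cost_def by (induct p) auto
  then show ?thesis
    unfolding graph_dist_def \<mu>_def awalk_def by simp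
qed

lemma graph_dist_le_length:
  assumes "pair_wf_digraph T" "u \<in> pverts T" "set p \<subseteq> parcs T" "pcas u p v"
  shows "graph_dist T u v \<le> real (length p)"
  unfolding graph_dist_conv[OF assms(1)] by (rule INF_lower2[of p]) (use assms in auto)

text \<open>
  The image of a walk under a homomorphism is a walk of the same length.
\<close>

lemma graph_dist_hom_le:
  assumes wf: "pair_wf_digraph T" "pair_wf_digraph T'"
    and V: "h ` pverts T \<subseteq> pverts T'"
    and E: "\<And>a b. (a, b) \<in> parcs T \<Longrightarrow> (h a, h b) \<in> parcs T'"
  shows "graph_dist T' (h u) (h v) \<le> graph_dist T u v"
  unfolding graph_dist_conv[OF wf(1)]
proof (rule INF_greatest)
  fix p assume p: "p \<in> {p. u \<in> pverts T \<and> set p \<subseteq> parcs T \<and> pcas u p v}"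
  have "pcas (h u) (map (map_prod h h) p) (h v)" if "pcas u p v" for u
    using that by (induct p arbitrary: u) auto
  then have "graph_dist T' (h u) (h v) \<le> real (length (map (map_prod h h) p))"
    using p V E by (intro graph_dist_le_length[OF wf(2)]) auto
  then show "graph_dist T' (h u) (h v) \<le> ereal (real (length p))" by simp
qed

lemma tree_has_neighbour:
  assumes "undirected_tree T" "y \<in> pverts T" "pverts T \<noteq> {y}"
  obtains z where "(y, z) \<in> parcs T"
proof -
  obtain v where "v \<in> pverts T" "v \<noteq> y" using assms by blast
  then have "(y, v) \<in> (parcs T)\<^sup>*" "v \<noteq> y" using assms unfolding undirected_tree_iff by blast+
  then show thesis using that by (metis converse_rtranclE)
qed

text \<open>
  Two adjacent leaves have no neighbours but each other, so they form a connected component.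
\<close>

lemma adjacent_leaves:
  assumes T: "undirected_tree T" and l: "l \<in> leaves T" "p \<in> leaves T" and lp: "(l, p) \<in> parcs T"
  shows "pverts T = {l, p}"
proof -
  have "(p, l) \<in> parcs T" and V: "l \<in> pverts T" "p \<in> pverts T" and "l \<noteq> p"
    using T lp unfolding undirected_tree_iff by (auto dest: symD simp: irrefl_def)
  then have step: "b \<in> {l, p}" if "(a, b) \<in> parcs T" "a \<in> {l, p}" for a b
    using that l lp by (auto simp: mem_leaves_iff)
  have "v \<in> {l, p}" if "(l, v) \<in> (parcs T)\<^sup>*" for v
    using that by induct (auto dest: step)
  then show ?thesis
    using T V unfolding undirected_tree_iff by blast
qed


section \<open>Attaching and deleting a leaf\<close>

definition add_leaf :: "'a pair_pre_digraph \<Rightarrow> 'a \<Rightarrow> 'a \<Rightarrow> 'a pair_pre_digraph" where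
  "add_leaf T y x = \<lparr> pverts = insert x (pverts T), parcs = {(x, y), (y, x)} \<union> parcs T \<rparr>"

lemma add_leaf_simps [simp]:
  "pverts (add_leaf T y x) = insert x (pverts T)"
  "parcs (add_leaf T y x) = {(x, y), (y, x)} \<union> parcs T"
  by (simp_all add: add_leaf_def)

text \<open>
  A cycle cannot use a pendant edge: it would enter \<open>x\<close> from \<open>y\<close> and leave \<open>x\<close> towards \<open>y\<close>,
  and so visit \<open>y\<close> twice, unless it has length 2.
\<close>

lemma closed_walk_avoids:
  assumes p: "set p \<subseteq> {(x, y), (y, x)} \<union> E" "pcas u p u" "distinct (map snd p)" "length p \<ge> 3"
    and x: "\<And>z. (x, z) \<notin> E" "\<And>z. (z, x) \<notin> E" "x \<noteq> y"
  shows "set p \<subseteq> E"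
proof (rule ccontr)
  assume "\<not> set p \<subseteq> E"
  then have arc: "(x, y) \<in> set p \<or> (y, x) \<in> set p" using p(1) by blast
  have tails: "fst ` set q \<subseteq> insert v (snd ` set q)" if "pcas v q w" for v w q
    using that by (induct q arbitrary: v) auto
  have target: "w \<in> snd ` set q" if "pcas v q w" "q \<noteq> []" for v w q
    using that
  proof (induct q arbitrary: v)
    case (Cons e q)
    then show ?case by (cases q) auto
  qed simp
  have "fst ` set p \<subseteq> snd ` set p"
    using tails[OF p(2)] target[OF p(2)] p(4) by fastforce
  then have "x \<in> snd ` set p" using arc by force
  then have "(y, x) \<in> set p" using p(1) x by force
  then obtain q r where qr: "p = q @ (y, x) # r" by (meson split_list)
  \<comment> \<open>rotate the cycle so that its last arc is \<open>(y, x)\<close>; \<open>c\<close> is the rest\<close>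
  define c where "c = r @ q"
  have "pcas x r u" "pcas u q y" using p(2) unfolding qr by (auto simp: pcas_append)
  then have c: "pcas x c y" unfolding c_def by (auto simp: pcas_append)
  have "length c \<ge> 2" using p(4) by (simp add: qr c_def)
  then obtain e e' c' where c_eq: "c = e # e' # c'" by (cases c; cases "tl c") auto
  have "x \<notin> snd ` set c" "distinct (map snd c)" using p(3) by (auto simp: qr c_def)
  moreover have "e = (x, y)"
  proof -
    have "e \<in> set c" "fst e = x" using c by (auto simp: c_eq)
    then have "e \<in> {(x, y), (y, x)} \<union> E" "fst e = x" using p(1) by (auto simp: qr c_def)
    then show ?thesis using x by (cases e) auto
  qed
  \<comment> \<open>\<open>c\<close> arrives at \<open>y\<close> both with its first arc and with its last one\<close>
  ultimately show False
    using c target[of y "e' # c'" y] by (auto simp: c_eq)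
qed

lemma undirected_tree_add_leaf:
  assumes T: "undirected_tree T" and y: "y \<in> pverts T" and x: "x \<notin> pverts T"
  shows "undirected_tree (add_leaf T y x)"
proof -
  let ?E = "parcs (add_leaf T y x)"
  from T have E: "parcs T \<subseteq> pverts T \<times> pverts T" and fin: "finite (pverts T)"
    and sym: "sym (parcs T)" and irr: "irrefl (parcs T)"
    and con: "\<And>u v. u \<in> pverts T \<Longrightarrow> v \<in> pverts T \<Longrightarrow> (u, v) \<in> (parcs T)\<^sup>*"
    and cyc: "\<And>u p. set p \<subseteq> parcs T \<Longrightarrow> pcas u p u \<Longrightarrow> distinct (map snd p) \<Longrightarrow> length p < 3"
    unfolding undirected_tree_iff by blast+
  have mono: "(parcs T)\<^sup>* \<subseteq> ?E\<^sup>*" by (rule rtrancl_mono) auto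
  have to_y: "(u, y) \<in> ?E\<^sup>*" and from_y: "(y, u) \<in> ?E\<^sup>*" if "u \<in> insert x (pverts T)" for u
    using that con[of u y] con[of y u] y mono by (auto intro: r_into_rtrancl)
  have "length p < 3" if "set p \<subseteq> ?E" "pcas u p u" "distinct (map snd p)" for u p
    using that closed_walk_avoids[of p x y "parcs T" u] cyc[of p u] E x y
    by (force simp: not_less[symmetric])
  moreover have "sym ?E" using sym by (auto simp: sym_def)
  moreover have "irrefl ?E" using irr x y by (auto simp: irrefl_def)
  moreover have "(u, v) \<in> ?E\<^sup>*" if "u \<in> insert x (pverts T)" "v \<in> insert x (pverts T)" for u v
    using to_y[OF that(1)] from_y[OF that(2)] by (rule rtrancl_trans)
  ultimately show ?thesis
    using E fin y unfolding undirected_tree_iff by auto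
qed

text \<open>
  This is the converse of \<open>undirected_tree_add_leaf\<close>. The smaller graph is connected because
  moving \<open>x\<close> to its neighbour maps each walk of \<open>T\<close> to a walk that avoids \<open>x\<close>.
\<close>

lemma leaf_decomposition:
  assumes T: "undirected_tree T" and x: "x \<in> leaves T" "pverts T \<noteq> {x}"
  obtains T' y where "undirected_tree T'" "y \<in> pverts T'" "x \<notin> pverts T'" "T = add_leaf T' y x"
proof -
  from T have E: "parcs T \<subseteq> pverts T \<times> pverts T" and fin: "finite (pverts T)"
    and sym: "sym (parcs T)" and irr: "irrefl (parcs T)"
    and con: "\<And>u v. u \<in> pverts T \<Longrightarrow> v \<in> pverts T \<Longrightarrow> (u, v) \<in> (parcs T)\<^sup>*"
    and cyc: "\<And>u p. set p \<subseteq> parcs T \<Longrightarrow> pcas u p u \<Longrightarrow> distinct (map snd p) \<Longrightarrow> length p < 3"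
    unfolding undirected_tree_iff by blast+
  obtain y where xy: "\<And>z. (x, z) \<in> parcs T \<longleftrightarrow> z = y" and xV: "x \<in> pverts T"
    using x by (auto simp: mem_leaves_iff)
  have yx: "\<And>z. (z, x) \<in> parcs T \<longleftrightarrow> z = y" using xy sym by (metis symD)
  have y: "y \<in> pverts T" "y \<noteq> x" using xy E irr by (auto simp: irrefl_def)
  define T' where "T' = \<lparr> pverts = pverts T - {x}, parcs = parcs T - {(x, y), (y, x)} \<rparr>"
  have E': "parcs T' \<subseteq> pverts T' \<times> pverts T'"
    using E xy yx unfolding T'_def by auto
  let ?h = "\<lambda>v. if v = x then y else v"
  have hom: "(?h u, ?h v) \<in> (parcs T')\<^sup>*" if "(u, v) \<in> (parcs T)\<^sup>*" for u v
    using that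
  proof induct
    case (step b c)
    have "(?h b, ?h c) \<in> (parcs T')\<^sup>*"
    proof (cases "(b, c) \<in> parcs T'")
      case True
      then have "b \<noteq> x" "c \<noteq> x" using E' by (auto simp: T'_def)
      then show ?thesis using True by auto
    next
      case False
      then have "(b, c) \<in> {(x, y), (y, x)}" using step by (auto simp: T'_def)
      then show ?thesis using y by auto
    qed
    with step(3) show ?case by (rule rtrancl_trans)
  qed simp
  have con': "(u, v) \<in> (parcs T')\<^sup>*" if "u \<in> pverts T'" "v \<in> pverts T'" for u v
    using hom[OF con[of u v]] that by (auto simp: T'_def split: if_splits)
  have "undirected_tree T'"
    unfolding undirected_tree_iff
  proof (intro conjI allI impI ballI)
    show "length p < 3" if "set p \<subseteq> parcs T'" "pcas u p u" "distinct (map snd p)" for u p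
      by (rule cyc) (use that in \<open>auto simp: T'_def\<close>)
  qed (use E' con' fin y sym irr in \<open>auto simp: T'_def sym_def irrefl_def\<close>)
  moreover have "T = add_leaf T' y x"
    using xV xy yx by (cases T) (auto simp: add_leaf_def T'_def)
  moreover have "y \<in> pverts T'" "x \<notin> pverts T'"
    using y by (simp_all add: T'_def)
  ultimately show thesis using that by blast
qed

lemma leaves_add_leaf:
  assumes T: "undirected_tree T" and y: "y \<in> pverts T" and x: "x \<notin> pverts T"
    and ne: "pverts T \<noteq> {y}"
  shows "leaves (add_leaf T y x) = insert x (leaves T - {y})"
proof -
  have E: "parcs T \<subseteq> pverts T \<times> pverts T"
    using T by (simp add: undirected_tree_iff)
  then have nx: "(x, z) \<notin> parcs T" "(z, x) \<notin> parcs T" for z using x by auto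
  obtain z where z: "(y, z) \<in> parcs T" using tree_has_neighbour[OF T y ne] .
  have "z \<noteq> x" "y \<noteq> x" using z nx y x by auto
  then have "y \<notin> leaves (add_leaf T y x)"
    using z unfolding mem_leaves_iff add_leaf_simps by blast
  moreover have "x \<in> leaves (add_leaf T y x)"
    using x y nx by (auto simp: mem_leaves_iff)
  moreover have "v \<in> leaves (add_leaf T y x) \<longleftrightarrow> v \<in> leaves T" if "v \<noteq> x" "v \<noteq> y" for v
    using that x y by (auto simp: mem_leaves_iff)
  moreover have "x \<notin> leaves T" using x by (simp add: mem_leaves_iff)
  ultimately show ?thesis by (intro set_eqI) (metis DiffE DiffI insert_iff singletonI singletonD)
qed

text \<open>
  In the one-vertex tree the vertex \<open>y\<close> is a leaf by convention, and it stays one when it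
  acquires its first neighbour.
\<close>

lemma leaves_add_leaf_singleton:
  assumes "undirected_tree T" "pverts T = {y}" "x \<noteq> y"
  shows "leaves (add_leaf T y x) = {x, y}"
proof -
  have "parcs T = {}" using assms by (auto simp: undirected_tree_iff irrefl_def)
  then show ?thesis using assms by (auto simp: mem_leaves_iff)
qed

text \<open>
  The inclusion of \<open>T\<close> and the folding of the new leaf \<open>x\<close> onto a neighbour of \<open>y\<close> in \<open>T\<close> are
  homomorphisms, and both fix \<open>T\<close>. Two distinct vertices of \<open>T\<close> ensure that \<open>y\<close> has a neighbour.
\<close>

lemma graph_dist_add_leaf:
  assumes T: "undirected_tree T" and y: "y \<in> pverts T" and x: "x \<notin> pverts T"
    and u: "u \<in> pverts T" and v: "v \<in> pverts T" and "u \<noteq> v"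
  shows "graph_dist (add_leaf T y x) u v = graph_dist T u v"
proof (rule antisym)
  note wf = tree_imp_pair_wf[OF T] tree_imp_pair_wf[OF undirected_tree_add_leaf[OF T y x]]
  show "graph_dist (add_leaf T y x) u v \<le> graph_dist T u v"
    using graph_dist_hom_le[OF wf, of id] by auto
  have "pverts T \<noteq> {y}" using u v \<open>u \<noteq> v\<close> by auto
  then obtain z where z: "(y, z) \<in> parcs T" using tree_has_neighbour[OF T y] by blast
  have E: "parcs T \<subseteq> pverts T \<times> pverts T" and sym: "sym (parcs T)"
    using T by (simp_all add: undirected_tree_iff)
  have "graph_dist T ((id(x := z)) u) ((id(x := z)) v) \<le> graph_dist (add_leaf T y x) u v"
    by (rule graph_dist_hom_le[OF wf(2,1)]) (use E x y z symD[OF sym z] in auto)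
  then show "graph_dist T u v \<le> graph_dist (add_leaf T y x) u v"
    using u v x by (auto split: if_splits)
qed

text \<open>
  As long as there is a leaf outside \<open>S\<close>, delete it. The members of \<open>S\<close> remain leaves, since a
  member that loses its only neighbour becomes the vertex of a one-vertex tree.
\<close>

lemma prune_to_leaf_subset:
  assumes "undirected_tree T" "S \<subseteq> leaves T" "S \<noteq> {}"
  shows "\<exists>T'. undirected_tree T' \<and> leaves T' = S \<and>
    (\<forall>u \<in> S. \<forall>v \<in> S. u \<noteq> v \<longrightarrow> graph_dist T' u v = graph_dist T u v)"
  using assms
proof (induct "card (pverts T)" arbitrary: T rule: less_induct)
  case less
  note T = \<open>undirected_tree T\<close>
  show ?case
  proof (cases "leaves T = S")
    case True
    then show ?thesis using T by blast
  next
    case False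
    then obtain x where x: "x \<in> leaves T" "x \<notin> S" using less.prems by blast
    have SV: "S \<subseteq> pverts T" using less.prems by (auto simp: mem_leaves_iff)
    then have "pverts T \<noteq> {x}" using less.prems x by auto
    then obtain T' y where T': "undirected_tree T'" "y \<in> pverts T'" "x \<notin> pverts T'"
      and eq: "T = add_leaf T' y x" using leaf_decomposition[OF T x(1)] by blast
    have fin: "finite (pverts T')" using T' by (simp add: undirected_tree_iff)
    have sub: "S \<subseteq> leaves T'"
    proof (cases "pverts T' = {y}")
      case True
      then show ?thesis using SV x eq by (auto simp: mem_leaves_iff)
    next
      case False
      then show ?thesis using leaves_add_leaf[OF T' False] less.prems x eq by auto
    qed
    have "card (pverts T') < card (pverts T)" using eq T' fin by simp
    from less.hyps[OF this T'(1) sub less.prems(3)]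
    obtain T'' where T'': "undirected_tree T''" "leaves T'' = S"
      "\<forall>u \<in> S. \<forall>v \<in> S. u \<noteq> v \<longrightarrow> graph_dist T'' u v = graph_dist T' u v" by blast
    have "S \<subseteq> pverts T'" using sub by (auto simp: mem_leaves_iff)
    then have "graph_dist T u v = graph_dist T' u v" if "u \<in> S" "v \<in> S" "u \<noteq> v" for u v
      using graph_dist_add_leaf[OF T'] that eq by blast
    then show ?thesis using T'' by auto
  qed
qed

section \<open>Leaf roots\<close>

text \<open>
  The vertex set and the arc relation are separate arguments, so that vertices can be added to
  \<open>V\<close> while \<open>E\<close> remains fixed.
\<close>

definition leaf_root ::
    "nat \<Rightarrow> nat pair_pre_digraph \<Rightarrow> ('a \<Rightarrow> nat) \<Rightarrow> 'a set \<Rightarrow> 'a rel \<Rightarrow> bool" where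
  "leaf_root k T f V E \<longleftrightarrow> undirected_tree T \<and> bij_betw f V (leaves T) \<and>
     (\<forall>u \<in> V. \<forall>v \<in> V. u \<noteq> v \<longrightarrow> ((u, v) \<in> E \<longleftrightarrow> graph_dist T (f u) (f v) = ereal (real k)))"

lemma exact_leaf_power_iff:
  "exact_leaf_power k G \<longleftrightarrow> (\<exists>T f. leaf_root k T f (pverts G) (parcs G))"
  unfolding exact_leaf_power_def leaf_root_def by blast

text \<open>
  The path \<open>1, 0, 2\<close> represents two isolated vertices because its leaves have distance
  at most \<open>2 < k\<close>.
\<close>

lemma leaf_root_two_isolated:
  assumes k: "k \<ge> 3" and ab: "a \<noteq> b" "(a, b) \<notin> E" "(b, a) \<notin> E"
  shows "\<exists>T f. leaf_root k T f {a, b} E \<and> card (pverts T) \<ge> 3"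
proof -
  define P1 where "P1 = \<lparr> pverts = {0::nat}, parcs = {} \<rparr>"
  define P2 where "P2 = add_leaf P1 0 1"
  define P3 where "P3 = add_leaf P2 0 2"
  have "length p < 3" if "set p \<subseteq> {}" for p :: "(nat \<times> nat) list" using that by simp
  then have P1: "undirected_tree P1"
    unfolding undirected_tree_iff P1_def by (auto simp: sym_def irrefl_def)
  have P2: "undirected_tree P2" unfolding P2_def
    by (rule undirected_tree_add_leaf[OF P1]) (auto simp: P1_def)
  have P3: "undirected_tree P3" unfolding P3_def
    by (rule undirected_tree_add_leaf[OF P2]) (auto simp: P1_def P2_def)
  have "leaves P2 = {0, 1}"
    unfolding P2_def by (subst leaves_add_leaf_singleton[OF P1]) (auto simp: P1_def)
  then have L: "leaves P3 = {1, 2}"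
    unfolding P3_def by (subst leaves_add_leaf[OF P2]) (auto simp: P1_def P2_def)
  have d: "graph_dist P3 1 2 \<le> 2" "graph_dist P3 2 1 \<le> 2"
    using graph_dist_le_length[OF tree_imp_pair_wf[OF P3], of 1 "[(1,0),(0,2)]" 2]
      graph_dist_le_length[OF tree_imp_pair_wf[OF P3], of 2 "[(2,0),(0,1)]" 1]
    by (auto simp: P3_def P2_def P1_def)
  have ne: "graph_dist P3 1 2 \<noteq> ereal (real k)" "graph_dist P3 2 1 \<noteq> ereal (real k)"
    using d k by auto
  have "leaf_root k P3 (\<lambda>v. if v = a then 1 else 2) {a, b} E"
    unfolding leaf_root_def using P3 L ab ne by (auto simp: bij_betw_def)
  moreover have "card (pverts P3) \<ge> 3" by (simp add: P3_def P2_def P1_def)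
  ultimately show ?thesis by blast
qed

text \<open>
  If the tree is a single edge, then its two leaves have distance \<open>1 < k\<close>, so \<open>V\<close> consists of
  two isolated vertices, which the path with three vertices represents as well.
\<close>

lemma leaf_root_large_tree:
  assumes k: "k \<ge> 3" and root: "leaf_root k T f V E" and ab: "a \<in> V" "b \<in> V" "a \<noteq> b"
  shows "\<exists>T f. leaf_root k T f V E \<and> card (pverts T) \<ge> 3"
proof (cases "card (pverts T) \<ge> 3")
  case True
  then show ?thesis using root by blast
next
  case False
  from root have T: "undirected_tree T" and bij: "bij_betw f V (leaves T)"
    and E: "\<And>u v. u \<in> V \<Longrightarrow> v \<in> V \<Longrightarrow> u \<noteq> v \<Longrightarrow>
      ((u, v) \<in> E \<longleftrightarrow> graph_dist T (f u) (f v) = ereal (real k))"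
    unfolding leaf_root_def by blast+
  have fin: "finite (pverts T)" and arcs: "parcs T \<subseteq> pverts T \<times> pverts T"
    and irr: "irrefl (parcs T)" and sym: "sym (parcs T)"
    using T by (simp_all add: undirected_tree_iff)
  have sub: "leaves T \<subseteq> pverts T" by (auto simp: mem_leaves_iff)
  have fab: "f a \<in> leaves T" "f b \<in> leaves T" "f a \<noteq> f b"
    using bij ab by (auto simp: bij_betw_def inj_on_def)
  have "card {f a, f b} = 2" using fab by simp
  then have VT: "pverts T = {f a, f b}"
    using card_seteq[OF fin, of "{f a, f b}"] False fab sub by auto
  have "leaves T = {f a, f b}" using fab sub unfolding VT by blast
  then have img: "f ` V = f ` {a, b}"
    using bij_betw_imp_surj_on[OF bij] by simp
  have "{a, b} \<subseteq> V" using ab by simp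
  from inj_on_image_eq_iff[OF bij_betw_imp_inj_on[OF bij] order_refl this] img
  have V: "V = {a, b}" by blast
  have "f a \<in> pverts T" "pverts T \<noteq> {f a}" using fab(3) unfolding VT by auto
  then obtain z where "(f a, z) \<in> parcs T"
    by (rule tree_has_neighbour[OF T])
  then have "z \<in> {f a, f b}" "z \<noteq> f a" using arcs irr unfolding VT irrefl_def by blast+
  then have e: "(f a, f b) \<in> parcs T" using \<open>(f a, z) \<in> parcs T\<close> by simp
  have "graph_dist T (f a) (f b) \<le> ereal 1" "graph_dist T (f b) (f a) \<le> ereal 1"
    using graph_dist_le_length[OF tree_imp_pair_wf[OF T], of "f a" "[(f a, f b)]" "f b"]
      graph_dist_le_length[OF tree_imp_pair_wf[OF T], of "f b" "[(f b, f a)]" "f a"]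
      e symD[OF sym e] VT by auto
  then have "graph_dist T (f a) (f b) \<noteq> ereal (real k)" "graph_dist T (f b) (f a) \<noteq> ereal (real k)"
    using k by auto
  then have "(a, b) \<notin> E" "(b, a) \<notin> E"
    using E[OF ab] E[OF ab(2,1) ab(3)[symmetric]] by simp_all
  then show ?thesis unfolding V by (rule leaf_root_two_isolated[OF k ab(3)])
qed

text \<open>
  The new leaf \<open>n\<close> is attached to the neighbour \<open>p\<close> of the leaf \<open>l\<close> that represents \<open>y\<close>. Two
  homomorphisms show that \<open>n\<close> has the same distances as \<open>l\<close>: the folding of \<open>n\<close> onto \<open>l\<close>, and
  the embedding of the old tree that moves \<open>l\<close> to \<open>n\<close>.
\<close>

lemma leaf_root_add_twin:
  assumes k: "k \<ge> 3" and root: "leaf_root k T f V E" and y: "y \<in> V" and x: "x \<notin> V"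
    and xy: "(x, y) \<notin> E" "(y, x) \<notin> E"
    and twin: "\<And>z. z \<in> V \<Longrightarrow> z \<noteq> y \<Longrightarrow> ((x, z) \<in> E \<longleftrightarrow> (y, z) \<in> E) \<and> ((z, x) \<in> E \<longleftrightarrow> (z, y) \<in> E)"
  shows "\<exists>T f. leaf_root k T f (insert x V) E"
proof (cases "V = {y}")
  case True
  have "x \<noteq> y" using x y by blast
  from leaf_root_two_isolated[OF k this xy] show ?thesis unfolding True by blast
next
  case False
  then obtain b where "b \<in> V" "b \<noteq> y" using y by blast
  then obtain T f where root: "leaf_root k T f V E" and card: "card (pverts T) \<ge> 3"
    using leaf_root_large_tree[OF k root y] by metis
  from root have T: "undirected_tree T" and bij: "bij_betw f V (leaves T)"
    and E: "\<And>u v. u \<in> V \<Longrightarrow> v \<in> V \<Longrightarrow> u \<noteq> v \<Longrightarrow>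
      ((u, v) \<in> E \<longleftrightarrow> graph_dist T (f u) (f v) = ereal (real k))"
    unfolding leaf_root_def by blast+
  have fin: "finite (pverts T)" and arcs: "parcs T \<subseteq> pverts T \<times> pverts T"
    and irr: "irrefl (parcs T)" and sym: "sym (parcs T)"
    using T by (simp_all add: undirected_tree_iff)
  define l where "l = f y"
  have l: "l \<in> leaves T" using bij y by (auto simp: l_def bij_betw_def)
  have "pverts T \<noteq> {l}" using card by auto
  then obtain p where p: "\<And>z. (l, z) \<in> parcs T \<longleftrightarrow> z = p"
    using l by (auto simp: mem_leaves_iff)
  have p': "(z, l) \<in> parcs T \<longleftrightarrow> z = p" for z
    using p[of z] symD[OF sym, of z l] symD[OF sym, of l z] by blast
  have lp: "(l, p) \<in> parcs T" "(p, l) \<in> parcs T" using p p' by simp_all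
  have V: "l \<in> pverts T" "p \<in> pverts T" "l \<noteq> p" using lp arcs irr by (auto simp: irrefl_def)
  have "p \<notin> leaves T"
  proof
    assume "p \<in> leaves T"
    then have "pverts T = {l, p}" by (rule adjacent_leaves[OF T l _ lp(1)])
    then show False using card V by simp
  qed
  obtain n where n: "n \<notin> pverts T" using fin ex_new_if_finite infinite_UNIV_nat by blast
  define T' where "T' = add_leaf T p n"
  have T': "undirected_tree T'"
    unfolding T'_def by (rule undirected_tree_add_leaf[OF T V(2) n])
  have L: "leaves T' = insert n (leaves T)"
    unfolding T'_def using leaves_add_leaf[OF T V(2) n] \<open>p \<notin> leaves T\<close> V(1,3) by blast
  have sub: "leaves T \<subseteq> pverts T" by (auto simp: mem_leaves_iff)
  note wf = tree_imp_pair_wf[OF T] tree_imp_pair_wf[OF T']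
  have fold_le: "graph_dist T ((id(n := l)) u) ((id(n := l)) v) \<le> graph_dist T' u v" for u v
  proof (rule graph_dist_hom_le[OF wf(2,1)])
    show "((id(n := l)) a, (id(n := l)) b) \<in> parcs T" if "(a, b) \<in> parcs T'" for a b
    proof (cases "(a, b) \<in> parcs T")
      case True
      then show ?thesis using arcs n by auto
    next
      case False
      then have "(a, b) = (n, p) \<or> (a, b) = (p, n)" using that by (auto simp: T'_def)
      then show ?thesis using lp n V by auto
    qed
  qed (use V in \<open>auto simp: T'_def\<close>)
  have swap_le: "graph_dist T' ((id(l := n)) u) ((id(l := n)) v) \<le> graph_dist T u v" for u v
  proof (rule graph_dist_hom_le[OF wf])
    show "((id(l := n)) a, (id(l := n)) b) \<in> parcs T'" if "(a, b) \<in> parcs T" for a b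
      using that p[of b] p'[of a] \<open>l \<noteq> p\<close> by (auto simp: T'_def)
  qed (auto simp: T'_def)
  have dn: "graph_dist T' n z = graph_dist T l z" "graph_dist T' z n = graph_dist T z l"
    if "z \<in> pverts T" "z \<noteq> l" for z
  proof -
    have "z \<noteq> n" using that n by blast
    then show "graph_dist T' n z = graph_dist T l z" "graph_dist T' z n = graph_dist T z l"
      using fold_le[of n z] fold_le[of z n] swap_le[of l z] swap_le[of z l] that
      by (simp_all add: order_antisym)
  qed
  have "graph_dist T' n l \<le> 2" "graph_dist T' l n \<le> 2"
    using graph_dist_le_length[OF wf(2), of n "[(n,p),(p,l)]" l]
      graph_dist_le_length[OF wf(2), of l "[(l,p),(p,n)]" n] lp V
    by (auto simp: T'_def)
  then have nl: "graph_dist T' n l \<noteq> ereal (real k)" "graph_dist T' l n \<noteq> ereal (real k)"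
    using k by auto
  have fV: "f z \<in> pverts T" if "z \<in> V" for z
    using bij sub that by (auto simp: bij_betw_def)
  have fl: "f z \<noteq> l" if "z \<in> V" "z \<noteq> y" for z
    using bij y that by (auto simp: bij_betw_def inj_on_def l_def)
  let ?g = "f(x := n)"
  have "bij_betw ?g (insert x V) (leaves T')"
  proof -
    have "n \<notin> leaves T" using n sub by blast
    moreover have "bij_betw ?g V (leaves T)"
      using bij x by (subst bij_betw_cong[of V ?g f]) auto
    ultimately show ?thesis unfolding L
      using notIn_Un_bij_betw[of x V ?g "leaves T"] x by simp
  qed
  moreover have "(u, v) \<in> E \<longleftrightarrow> graph_dist T' (?g u) (?g v) = ereal (real k)"
    if uv: "u \<in> insert x V" "v \<in> insert x V" "u \<noteq> v" for u v
  proof -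
    consider "u \<in> V" "v \<in> V" | "u = x" "v = y" | "u = y" "v = x"
      | "u = x" "v \<in> V" "v \<noteq> y" | "v = x" "u \<in> V" "u \<noteq> y" using uv by blast
    then show ?thesis
    proof cases
      case 1
      then have "f u \<noteq> f v" using bij uv by (auto simp: bij_betw_def inj_on_def)
      then have "graph_dist T' (f u) (f v) = graph_dist T (f u) (f v)"
        unfolding T'_def by (intro graph_dist_add_leaf[OF T V(2) n]) (use 1 fV in auto)
      moreover have "u \<noteq> x" "v \<noteq> x" using 1 x by blast+
      ultimately show ?thesis using E[OF 1 uv(3)] by simp
    next
      case 2
      moreover have "y \<noteq> x" using x y by blast
      ultimately show ?thesis using xy nl by (simp add: l_def)
    next
      case 3
      moreover have "y \<noteq> x" using x y by blast
      ultimately show ?thesis using xy nl by (simp add: l_def)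
    next
      case 4
      then have "v \<noteq> x" using x by blast
      then show ?thesis
        using 4 twin[of v] E[OF y, of v] dn(1)[OF fV fl, of v] by (simp add: l_def)
    next
      case 5
      then have "u \<noteq> x" using x by blast
      then show ?thesis
        using 5 twin[of u] E[OF _ y, of u] dn(2)[OF fV fl, of u] by (simp add: l_def)
    qed
  qed
  ultimately have "leaf_root k T' ?g (insert x V) E"
    unfolding leaf_root_def using T' by blast
  then show ?thesis by blast
qed

section \<open>Stable blow-ups\<close>

theorem theorem7p3:
  fixes G :: "'b pair_pre_digraph" and H :: "'a pair_pre_digraph" and k :: nat
  assumes "k \<ge> 3"
    and "simple_graph H"
    and "stable_blow_up G H"
  shows "exact_leaf_power k G \<longleftrightarrow> exact_leaf_power k H"
proof -
  have H: "pair_graph H" and neH: "pverts H \<noteq> {}"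
    using \<open>simple_graph H\<close> by (simp_all add: simple_graph_def)
  then have finH: "finite (pverts H)" and arcsH: "parcs H \<subseteq> pverts H \<times> pverts H"
    and irrH: "irrefl (parcs H)"
    by (simp_all add: pair_graph_iff)
  obtain I where I: "\<forall>v \<in> pverts H. finite (I v) \<and> I v \<noteq> {}"
    and dis: "disjoint_family_on I (pverts H)"
    and V: "pverts G = (\<Union>v \<in> pverts H. I v)"
    and E: "parcs G = (\<Union>(u, v) \<in> parcs H. I u \<times> I v)"
    using \<open>stable_blow_up G H\<close> unfolding stable_blow_up_def by (elim exE conjE)
  have finG: "finite (pverts G)" unfolding V using finH I by blast
  define cls where "cls x = (THE v. v \<in> pverts H \<and> x \<in> I v)" for x
  have cls_eq: "cls x = v" if "v \<in> pverts H" "x \<in> I v" for x v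
    unfolding cls_def by (rule the_equality) (use that dis in \<open>auto simp: disjoint_family_on_def\<close>)
  have cls: "cls x \<in> pverts H" "x \<in> I (cls x)" if "x \<in> pverts G" for x
    using that cls_eq unfolding V by auto
  have arc: "(x, y) \<in> parcs G \<longleftrightarrow> (cls x, cls y) \<in> parcs H"
    if "x \<in> pverts G" "y \<in> pverts G" for x y
  proof
    assume "(x, y) \<in> parcs G"
    then obtain u v where "(u, v) \<in> parcs H" "x \<in> I u" "y \<in> I v" unfolding E by blast
    then show "(cls x, cls y) \<in> parcs H" using cls_eq arcsH by auto
  next
    assume "(cls x, cls y) \<in> parcs H"
    then show "(x, y) \<in> parcs G" unfolding E using cls that by blast
  qed
  \<comment> \<open>a representative of each class, which makes \<open>H\<close> an induced subgraph of \<open>G\<close>\<close>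
  obtain s where s: "\<And>v. v \<in> pverts H \<Longrightarrow> s v \<in> I v"
    using I bchoice[of "pverts H" "\<lambda>v x. x \<in> I v"] by blast
  have sG: "s v \<in> pverts G" if "v \<in> pverts H" for v using s that unfolding V by blast
  have cls_s: "cls (s v) = v" if "v \<in> pverts H" for v using cls_eq s that by blast
  have inj_s: "inj_on s (pverts H)" using cls_s by (metis inj_onI)
  show ?thesis
  proof
    assume "exact_leaf_power k G"
    then obtain T f where root: "leaf_root k T f (pverts G) (parcs G)"
      unfolding exact_leaf_power_iff by blast
    then have T: "undirected_tree T" and bij: "bij_betw f (pverts G) (leaves T)"
      and fE: "\<And>u v. u \<in> pverts G \<Longrightarrow> v \<in> pverts G \<Longrightarrow> u \<noteq> v \<Longrightarrow>
        ((u, v) \<in> parcs G \<longleftrightarrow> graph_dist T (f u) (f v) = ereal (real k))"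
      unfolding leaf_root_def by blast+
    let ?g = "f \<circ> s" and ?S = "(f \<circ> s) ` pverts H"
    have sub: "?S \<subseteq> leaves T" using bij sG by (auto simp: bij_betw_def)
    have "s ` pverts H \<subseteq> pverts G" using sG by blast
    then have inj: "inj_on ?g (pverts H)"
      using comp_inj_on[OF inj_s inj_on_subset[OF bij_betw_imp_inj_on[OF bij]]] by blast
    obtain T' where T': "undirected_tree T'" "leaves T' = ?S"
      and d: "\<And>u v. u \<in> ?S \<Longrightarrow> v \<in> ?S \<Longrightarrow> u \<noteq> v \<Longrightarrow> graph_dist T' u v = graph_dist T u v"
      using prune_to_leaf_subset[OF T sub] neH by auto
    have "(u, v) \<in> parcs H \<longleftrightarrow> graph_dist T' (?g u) (?g v) = ereal (real k)"
      if uv: "u \<in> pverts H" "v \<in> pverts H" "u \<noteq> v" for u v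
    proof -
      have "?g u \<noteq> ?g v" using inj uv by (auto simp: inj_on_def)
      then have "graph_dist T' (?g u) (?g v) = graph_dist T (?g u) (?g v)" using d uv by blast
      moreover have "s u \<noteq> s v" using inj_s uv by (auto simp: inj_on_def)
      ultimately show ?thesis
        using fE[of "s u" "s v"] arc[of "s u" "s v"] cls_s sG uv by simp
    qed
    then have "leaf_root k T' ?g (pverts H) (parcs H)"
      unfolding leaf_root_def using T' inj by (auto simp: bij_betw_def)
    then show "exact_leaf_power k H" unfolding exact_leaf_power_iff by blast
  next
    assume "exact_leaf_power k H"
    then obtain T f where root: "leaf_root k T f (pverts H) (parcs H)"
      unfolding exact_leaf_power_iff by blast
    let ?R = "s ` pverts H"
    \<comment> \<open>every vertex outside \<open>?R\<close> enters as a twin of the representative of its class\<close>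
    have "\<exists>T f. leaf_root k T f (?R \<union> F) (parcs G)" if "finite F" "F \<subseteq> pverts G" for F
      using that
    proof (induct F)
      case empty
      have "bij_betw cls ?R (pverts H)"
        by (rule bij_betw_byWitness[where f' = s]) (use cls_s in auto)
      then have "bij_betw (f \<circ> cls) ?R (leaves T)"
        using root unfolding leaf_root_def by (blast intro: bij_betw_trans)
      moreover have "(u, v) \<in> parcs G \<longleftrightarrow> graph_dist T ((f \<circ> cls) u) ((f \<circ> cls) v) = ereal (real k)"
        if "u \<in> ?R" "v \<in> ?R" "u \<noteq> v" for u v
      proof -
        from that obtain a b where ab: "u = s a" "v = s b" "a \<in> pverts H" "b \<in> pverts H" by blast
        then have "a \<noteq> b" using that by blast
        then have "(a, b) \<in> parcs H \<longleftrightarrow> graph_dist T (f a) (f b) = ereal (real k)"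
          using root ab unfolding leaf_root_def by blast
        then show ?thesis using arc[of u v] ab sG cls_s by simp
      qed
      ultimately have "leaf_root k T (f \<circ> cls) ?R (parcs G)"
        using root unfolding leaf_root_def by blast
      then show ?case by auto
    next
      case (insert x F)
      then obtain T f where root: "leaf_root k T f (?R \<union> F) (parcs G)" by auto
      have xG: "x \<in> pverts G" using insert by blast
      let ?y = "s (cls x)"
      have yR: "?y \<in> ?R" and yG: "?y \<in> pverts G" and y: "cls ?y = cls x"
        using cls[OF xG] sG cls_s by auto
      show ?case
      proof (cases "x \<in> ?R")
        case True
        then have "?R \<union> insert x F = ?R \<union> F" by blast
        then show ?thesis using root by auto
      next
        case False
        have sub: "?R \<union> F \<subseteq> pverts G" using sG insert by blast
        have "\<exists>T f. leaf_root k T f (insert x (?R \<union> F)) (parcs G)"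
        proof -
          have loop: "(cls x, cls x) \<notin> parcs H" using irrH by (simp add: irrefl_def)
          show ?thesis
          proof (rule leaf_root_add_twin[OF \<open>k \<ge> 3\<close> root])
            show "?y \<in> ?R \<union> F" using yR by blast
            show "x \<notin> ?R \<union> F" using False insert.hyps by blast
            show "(x, ?y) \<notin> parcs G" "(?y, x) \<notin> parcs G"
              using arc[OF xG yG] arc[OF yG xG] y loop by simp_all
            fix z assume "z \<in> ?R \<union> F"
            then have zG: "z \<in> pverts G" using sub by blast
            show "((x, z) \<in> parcs G \<longleftrightarrow> (?y, z) \<in> parcs G) \<and>
                ((z, x) \<in> parcs G \<longleftrightarrow> (z, ?y) \<in> parcs G)"
              using arc[OF xG zG] arc[OF yG zG] arc[OF zG xG] arc[OF zG yG] y by simp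
          qed
        qed
        then show ?thesis by simp
      qed
    qed
    from this[OF finG order_refl] have "\<exists>T f. leaf_root k T f (pverts G) (parcs G)"
      using sG by (simp add: Un_absorb1 image_subset_iff)
    then show "exact_leaf_power k G" unfolding exact_leaf_power_iff .
  qed
qed

end
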